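(* Suppose that $K$ is $\sigma$-closed and convex. Let $F:K\rightrightarrows Y$ be a set-valued map with nonempty values satisfying assumption $(A)$, and let $B_E$ be $\sigma$-closed and sequentially compact with respect to the topology $\sigma$. Suppose that $F(K)$ is $P$-bounded, that for every $n\in\mathbb{N}$ the map $F$ is $\sigma q$-srgi on $K_n$, and that $$F^{G,\infty}_{\sigma}(u)>F^{G,\infty}_{\sigma}(0)\quad\text{for all } u\in K_\sigma^\infty\setminus\{0\}.$$ Then $l\text{-}SWEff(F)$ is a nonempty subset of $K$, if the following condition holds: for any sequence $(\lambda_n)\subseteq\mathbb{R}$ and any unbounded sequence $(x_n)\subseteq K$ that satisfy $\lambda_n\downarrow M_F^q$, $x_n\in Colev_{<^l}(F,\lambda_n q)\cap K_n$ for each $n\in\mathbb{N}$, and $\|x_n\|\to+\infty$, there exist a subsequence $(x_{n_k})$ of $(x_n)$, a sequence $(w_k)\subseteq K$ and $d\in K_\sigma^\infty\setminus\{0\}$ such that $F(w_k)\leq^l F(x_{n_k})$ and $\|w_k\|\leq\|x_{n_k}\|$ for $k$ large enough, and $\frac{w_k}{\|w_k\|}\xrightarrow{\sigma}d$.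
   Context: Standing setting: $\mathbb{N}$ denotes the set of nonnegative integers. $(E,\|\cdot\|)$ is a (real) Banach space with closed unit ball $B_E$, and $\sigma$ is a topology on $E$ coarser than the norm topology such that $(E,\sigma)$ is a Hausdorff topological vector space; $\xrightarrow{\sigma}$ denotes convergence in $\sigma$. $K$ is a nonempty subset of $E$ and, for each $n\in\mathbb{N}$, $K_n:=\{x\in K:\|x\|\leq n\}$. $Y$ is a Hausdorff (real) topological vector space; $P\subseteq Y$ is a closed convex cone which is solid ($\mathrm{int}\,P\neq\emptyset$) and proper ($\{0\}\neq P\neq Y$); $q\in\mathrm{int}\,P$ is fixed. $F(K)=\bigcup_{x\in K}F(x)$. For nonempty $A,B\subseteq Y$: $A\leq^l B$ means $B\subseteq A+P$, and $A<^l B$ means $B\subseteq A+\mathrm{int}\,P$. $Colev_{<^l}(F,\lambda q):=\{x\in K: \{\lambda q\}\nless^l F(x)\}=\{x\in K: F(x)\not\subseteq \lambda q+\mathrm{int}\,P\}$. $l\text{-}SWEff(F)$ (strict weakly $l$-efficient solutions) is the set of $\bar x\in K$ such that there is no $x\in K$, $x\neq\bar x$, with $F(x)<^l F(\bar x)$. A nonempty set $A\subseteq Y$ is $P$-bounded if for each neighborhood $U$ of zero in $Y$ there is $r>0$ with $A\subseteq rU+P$. $\psi^q_P:Y\to\mathbb{R}$ is $\psi^q_P(y):=\sup\{t\in\mathbb{R}: y\in tq+P\}$. Assumption $(A)$ on $F$: $\psi^q_P$ attains its infimum on $F(x)$ for every $x$ in the domain $K$ of $F$. For a set-valued map $H:D\rightrightarrows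 Y$ with nonempty values, $M_H^q:=\sup\{t\in\mathbb{R}: H(D)\subseteq tq+P\}$ with $\sup\emptyset=-\infty$. If $D$ is a topological space, $H$ is $q$-srgi if whenever $x_0\in D\setminus Colev_{<^l}(H,\lambda q)$ for some real $\lambda>M_H^q$, there exist a neighborhood $U$ of $x_0$ in $D$ and a real $r>M_H^q$ with $U\subseteq D\setminus Colev_{<^l}(H,rq)$. "$F$ is $\sigma q$-srgi on $K_n$" means that the restriction $F|_{K_n}:K_n\rightrightarrows Y$ is $q$-srgi (with the infimal level $M^q_{F|_{K_n}}$ of the restriction), where $K_n$ carries the topology induced by $\sigma$. For $A\subseteq E$, the $\sigma$-asymptotic cone is $A^\infty_\sigma:=\{d\in E:\exists\, t_k\to+\infty,\ \exists\,(x_k)\subseteq A:\ \frac{x_k}{t_k}\xrightarrow{\sigma}d\}$ (sequences), with $\emptyset^\infty_\sigma=\emptyset$. The $qx$-$\sigma$-asymptotic function $F^{G,\infty}_\sigma:K^\infty_\sigma\to\mathbb{R}\cup\{\pm\infty\}$ is $F^{G,\infty}_\sigma(u)=\inf\{\lambda\in\mathbb{R}: u\in (Colev_{<^l}(F,\lambda q))^\infty_\sigma\}$. $\lambda_n\downarrow M_F^q$ means that $(\lambda_n)$ is a nonincreasing real sequence with $\lambda_n>M_F^q$ converging to $M_F^q$.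
   Formalization: In the condition on unbounded sequences, x_n ∈ Colev(F,λ_n q)∩K_n is required only for those n with K_n nonempty; if 0 ∉ K then K_0 is empty, the literal condition is vacuous and the claim fails. For 0 ∈ K nothing changes. *)

theory Defs
  imports "HOL-Analysis.Analysis"
begin

text \<open>
  A second topology on a vector space is a value of type \<open>'a topology\<close>.  The linear topology of
  \<open>Y\<close> is the one of its type class, written \<open>euclidean\<close> as an abstract topology (it need not be
  Euclidean).
\<close>

definition tvs_topology :: "'a::real_vector topology \<Rightarrow> bool" where
  "tvs_topology T \<longleftrightarrow>
     topspace T = UNIV \<and>
     continuous_map (prod_topology T T) T (\<lambda>(x, y). x + y) \<and>
     continuous_map (prod_topology euclideanreal T) T (\<lambda>(c, x). c *\<^sub>R x)"

definition seq_compactin :: "'a topology \<Rightarrow> 'a set \<Rightarrow> bool" where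
  "seq_compactin T S \<longleftrightarrow>
     (\<forall>x :: nat \<Rightarrow> 'a. range x \<subseteq> S \<longrightarrow>
        (\<exists>l\<in>S. \<exists>r. strict_mono r \<and> limitin T (x \<circ> r) l sequentially))"

definition lleq :: "'y::real_vector set \<Rightarrow> 'y set \<Rightarrow> 'y set \<Rightarrow> bool" where
  "lleq P A B \<longleftrightarrow> B \<subseteq> A + P"

definition lless :: "'y::{real_vector,topological_space} set \<Rightarrow> 'y set \<Rightarrow> 'y set \<Rightarrow> bool" where
  "lless P A B \<longleftrightarrow> B \<subseteq> A + interior P"

definition SWEff ::
    "'y::{real_vector,topological_space} set \<Rightarrow> ('e \<Rightarrow> 'y set) \<Rightarrow> 'e set \<Rightarrow> 'e set" where
  "SWEff P F K = {x \<in> K. \<not> (\<exists>y\<in>K. y \<noteq> x \<and> lless P (F y) (F x))}"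

definition P_bounded :: "'y::{real_vector,topological_space} set \<Rightarrow> 'y set \<Rightarrow> bool" where
  "P_bounded P A \<longleftrightarrow>
     (\<forall>U. 0 \<in> interior U \<longrightarrow> (\<exists>r>0. A \<subseteq> (\<lambda>u. r *\<^sub>R u) ` U + P))"

text \<open>
  If \<open>P\<close> is a closed convex cone, \<open>P \<noteq> Y\<close> and \<open>q\<close> is an interior point of \<open>P\<close>, the set below is
  nonempty and bounded above, so the supremum may be taken in the reals.
\<close>

definition psi :: "'y::real_vector set \<Rightarrow> 'y \<Rightarrow> 'y \<Rightarrow> real" where
  "psi P q y = Sup {t. y \<in> {t *\<^sub>R q} + P}"

definition assumption_A ::
    "'y::real_vector set \<Rightarrow> 'y \<Rightarrow> ('e \<Rightarrow> 'y set) \<Rightarrow> 'e set \<Rightarrow> bool" where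
  "assumption_A P q F K \<longleftrightarrow> (\<forall>x\<in>K. \<exists>y\<in>F x. \<forall>z\<in>F x. psi P q y \<le> psi P q z)"

text \<open>
  A set-valued map on \<open>D\<close> is given by a total function together with \<open>D\<close>; restricting it to a
  subset only changes \<open>D\<close>.
\<close>

definition Colev ::
    "'y::{real_vector,topological_space} set \<Rightarrow> 'y \<Rightarrow> ('e \<Rightarrow> 'y set) \<Rightarrow> 'e set \<Rightarrow> real \<Rightarrow> 'e set" where
  "Colev P q F D lam = {x \<in> D. \<not> lless P {lam *\<^sub>R q} (F x)}"

text \<open>Taken in \<^typ>\<open>ereal\<close>, where the supremum of the empty set is \<open>-\<infinity>\<close>.\<close>

definition inf_level ::
    "'y::real_vector set \<Rightarrow> 'y \<Rightarrow> ('e \<Rightarrow> 'y set) \<Rightarrow> 'e set \<Rightarrow> ereal" where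
  "inf_level P q F D = Sup (ereal ` {t. (\<Union>x\<in>D. F x) \<subseteq> {t *\<^sub>R q} + P})"

text \<open>The domain of the map is \<^term>\<open>topspace T\<close>.\<close>

definition srgi ::
    "'e topology \<Rightarrow> 'y::{real_vector,topological_space} set \<Rightarrow> 'y \<Rightarrow> ('e \<Rightarrow> 'y set) \<Rightarrow> bool" where
  "srgi T P q F \<longleftrightarrow>
     (let D = topspace T; M = inf_level P q F D in
      \<forall>x0 lam. ereal lam > M \<and> x0 \<in> D - Colev P q F D lam \<longrightarrow>
        (\<exists>U r. openin T U \<and> x0 \<in> U \<and> ereal r > M \<and> U \<subseteq> D - Colev P q F D r))"

definition asymp_cone :: "'e::real_vector topology \<Rightarrow> 'e set \<Rightarrow> 'e set" where
  "asymp_cone T A =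
     {d. \<exists>(t :: nat \<Rightarrow> real) (x :: nat \<Rightarrow> 'e).
           filterlim t at_top sequentially \<and> range x \<subseteq> A \<and>
           limitin T (\<lambda>k. x k /\<^sub>R t k) d sequentially}"

definition qx_asymp ::
    "'e::real_vector topology \<Rightarrow> 'y::{real_vector,topological_space} set \<Rightarrow> 'y \<Rightarrow>
     ('e \<Rightarrow> 'y set) \<Rightarrow> 'e set \<Rightarrow> 'e \<Rightarrow> ereal" where
  "qx_asymp T P q F K u = Inf (ereal ` {lam. u \<in> asymp_cone T (Colev P q F K lam)})"

definition ball_part :: "'e::real_normed_vector set \<Rightarrow> nat \<Rightarrow> 'e set" where
  "ball_part K n = {x \<in> K. norm x \<le> real n}"

definition decreases_to :: "(nat \<Rightarrow> real) \<Rightarrow> ereal \<Rightarrow> bool" where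
  "decreases_to lam M \<longleftrightarrow>
     decseq lam \<and> (\<forall>n. ereal (lam n) > M) \<and> (\<lambda>n. ereal (lam n)) \<longlonglongrightarrow> M"

text \<open>
  If \<open>0 \<notin> K\<close>, then \<open>K\<^sub>n = {}\<close> for the first few \<open>n\<close>, and no sequence satisfies \<open>x\<^sub>n \<in> K\<^sub>n\<close> for
  all \<open>n\<close>.  Requiring it of all \<open>n\<close> would make the condition vacuous (and the existence theorem
  false), so it is required of the \<open>n\<close> with \<open>K\<^sub>n \<noteq> {}\<close>, hence of all \<open>n\<close> if \<open>0 \<in> K\<close>.

  No \<open>w\<^sub>k \<noteq> 0\<close> is needed: \<open>w\<^sub>k /\<^sub>R norm w\<^sub>k\<close> is \<open>0\<close> if \<open>w\<^sub>k = 0\<close>, which the convergence to \<open>d \<noteq> 0\<close>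
  in a Hausdorff topology excludes for large \<open>k\<close>.
\<close>

definition unbounded_seq_condition ::
    "'e::real_normed_vector topology \<Rightarrow> 'y::{real_vector,topological_space} set \<Rightarrow> 'y \<Rightarrow>
     ('e \<Rightarrow> 'y set) \<Rightarrow> 'e set \<Rightarrow> bool" where
  "unbounded_seq_condition T P q F K \<longleftrightarrow>
     (\<forall>(lam :: nat \<Rightarrow> real) (x :: nat \<Rightarrow> 'e).
        range x \<subseteq> K \<and> \<not> bounded (range x) \<and>
        decreases_to lam (inf_level P q F K) \<and>
        (\<forall>n. ball_part K n \<noteq> {} \<longrightarrow> x n \<in> Colev P q F K (lam n) \<inter> ball_part K n) \<and>
        filterlim (\<lambda>n. norm (x n)) at_top sequentially
        \<longrightarrow>
        (\<exists>(s :: nat \<Rightarrow> nat) (w :: nat \<Rightarrow> 'e) d.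
           strict_mono s \<and> range w \<subseteq> K \<and> d \<in> asymp_cone T K - {0} \<and>
           (\<forall>\<^sub>F k in sequentially. lleq P (F (w k)) (F (x (s k))) \<and> norm (w k) \<le> norm (x (s k))) \<and>
           limitin T (\<lambda>k. w k /\<^sub>R norm (w k)) d sequentially))"

end

(*
  The minimum of psi over the value F x scalarises the problem: with g x = Min (psi ` F x) the
  colevel sets are the sublevel sets of g, M_F is the infimum of g, and a minimiser of g is strictly
  weakly l-efficient.  On each K_n the regularity of F and sequential compactness yield a minimiser
  x_n of g.  If g had no minimiser on K, every minimising sequence of g would leave all K_n; applied
  to (x_n) and to the sequence (w_k) given by the condition on unbounded sequences, this puts the
  direction d of (w_k) in the asymptotic cone of every nonempty colevel set of level above M_F.  So
  the qx-asymptotic function is at most M_F at d, whereas it is at least M_F at 0.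
*)

theory Submission
  imports Defs
begin

section \<open>Sequential compactness and asymptotic cones in an abstract topology\<close>

lemma seq_compactin_continuous_map_image:
  assumes "seq_compactin T S" "continuous_map T T' f"
  shows "seq_compactin T' (f ` S)"
  unfolding seq_compactin_def
proof (intro allI impI)
  fix y :: "nat \<Rightarrow> 'b"
  assume "range y \<subseteq> f ` S"
  then have "\<forall>n. \<exists>x\<in>S. y n = f x" by blast
  then obtain x where x: "\<And>n. x n \<in> S" "\<And>n. y n = f (x n)" by metis
  then obtain l r where l: "l \<in> S" "strict_mono r" "limitin T (x \<circ> r) l sequentially"
    using assms(1) unfolding seq_compactin_def by (meson image_subsetI)
  have "f \<circ> (x \<circ> r) = y \<circ> r" using x by auto
  then show "\<exists>l\<in>f ` S. \<exists>r. strict_mono r \<and> limitin T' (y \<circ> r) l sequentially"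
    using continuous_map_limit[OF assms(2) l(3)] l by auto
qed

lemma seq_compactin_Int_closedin:
  assumes "seq_compactin T S" "closedin T C"
  shows "seq_compactin T (C \<inter> S)"
  unfolding seq_compactin_def
proof (intro allI impI)
  fix x :: "nat \<Rightarrow> 'a"
  assume x: "range x \<subseteq> C \<inter> S"
  then obtain l r where l: "l \<in> S" "strict_mono r" "limitin T (x \<circ> r) l sequentially"
    using assms(1) unfolding seq_compactin_def by (meson le_inf_iff)
  moreover have "l \<in> C"
    using limitin_closedin[OF l(3) assms(2)] x by (auto simp: image_subset_iff)
  ultimately show "\<exists>l\<in>C \<inter> S. \<exists>r. strict_mono r \<and> limitin T (x \<circ> r) l sequentially"
    by blast
qed

lemma tvs_topology_continuous_map_scaleR:
  assumes "tvs_topology T"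
  shows "continuous_map T T (\<lambda>x. c *\<^sub>R x)"
proof -
  have "continuous_map T (prod_topology euclideanreal T) (\<lambda>x. (c, x))"
    by (auto intro: continuous_map_pairedI)
  from continuous_map_compose[OF this, of T "\<lambda>(c, x). c *\<^sub>R x"] show ?thesis
    using assms by (simp add: tvs_topology_def o_def)
qed

text \<open>Scaling by \<open>n\<close> is continuous for \<open>T\<close>, so the ball of radius
  \<open>n\<close> inherits sequential compactness from the unit ball; intersecting with the closed
  set \<open>K\<close> preserves it.\<close>

lemma seq_compactin_ball_part:
  fixes T :: "'e::real_normed_vector topology"
  assumes "tvs_topology T" "closedin T K" "seq_compactin T (cball 0 1)"
  shows "seq_compactin T (ball_part K n)"
proof -
  have "cball 0 (real n) = (\<lambda>x::'e. real n *\<^sub>R x) ` cball 0 1"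
    \<comment> \<open>\<open>cball_scale\<close> wants a nonzero factor; for \<open>n = 0\<close>
      both sides are \<open>{0}\<close>.\<close>
    using cball_scale[of "real n" 0 1] by (cases "n = 0") (auto simp: image_constant_conv)
  then have "ball_part K n = K \<inter> (\<lambda>x. real n *\<^sub>R x) ` cball 0 1"
    by (auto simp: ball_part_def set_eq_iff)
  then show ?thesis
    using assms by (metis seq_compactin_Int_closedin seq_compactin_continuous_map_image
        tvs_topology_continuous_map_scaleR)
qed

text \<open>A weak substitute for lower semicontinuity suffices: near a point above the infimum,
  \<open>g\<close> only has to stay above some level exceeding the infimum. A limit point of a
  minimising sequence cannot be such a point. The infimum lives in \<open>ereal\<close> because
  \<open>g\<close> is not assumed bounded below.\<close>

lemma seq_compactin_attains_min:
  fixes g :: "'a \<Rightarrow> real"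
  assumes S: "seq_compactin T S" "S \<noteq> {}"
    and reg: "\<And>x. x \<in> S \<Longrightarrow> (INF z\<in>S. ereal (g z)) < ereal (g x) \<Longrightarrow>
      \<exists>U r. openin (subtopology T S) U \<and> x \<in> U \<and> (INF z\<in>S. ereal (g z)) < ereal r \<and>
            (\<forall>u\<in>U. r < g u)"
  obtains x where "x \<in> S" "\<And>z. z \<in> S \<Longrightarrow> g x \<le> g z"
proof -
  define M where "M = (INF z\<in>S. ereal (g z))"
  obtain u where u: "\<And>n. u n \<in> (\<lambda>z. ereal (g z)) ` S" "u \<longlonglongrightarrow> M"
    using Inf_as_limit[of "(\<lambda>z. ereal (g z)) ` S"] S(2) unfolding M_def by auto
  then have "\<forall>n. \<exists>x\<in>S. u n = ereal (g x)" by blast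
  then obtain x where x: "\<And>n. x n \<in> S" "\<And>n. u n = ereal (g (x n))" by metis
  then obtain l r where l: "l \<in> S" "strict_mono r" "limitin T (x \<circ> r) l sequentially"
    using S(1) unfolding seq_compactin_def by (meson image_subsetI)
  have "ereal (g l) \<le> M"
  proof (rule ccontr)
    assume "\<not> ereal (g l) \<le> M"
    then obtain U c where U: "openin (subtopology T S) U" "l \<in> U" "M < ereal c" "\<forall>u\<in>U. c < g u"
      using reg[OF l(1)] unfolding M_def by (metis not_le)
    \<comment> \<open>\<open>U\<close> is open only relative to \<open>S\<close>, so convergence is
      moved to the subspace, which contains the sequence and its limit.\<close>
    have "limitin (subtopology T S) (x \<circ> r) l sequentially"
      using l x by (simp add: limitin_subtopology)
    then have "\<forall>\<^sub>F n in sequentially. x (r n) \<in> U"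
      using U by (simp add: limitin_def)
    moreover have "(u \<circ> r) \<longlonglongrightarrow> M"
      using u(2) l(2) by (rule LIMSEQ_subseq_LIMSEQ)
    then have "\<forall>\<^sub>F n in sequentially. u (r n) < ereal c"
      using U(3) by (auto dest: order_tendstoD(2))
    ultimately have "\<forall>\<^sub>F n in sequentially. False"
      by eventually_elim (use U(4) x(2) in force)
    then show False by simp
  qed
  then have "\<And>z. z \<in> S \<Longrightarrow> g l \<le> g z"
    unfolding M_def by (metis INF_lower ereal_less_eq(3) order_trans)
  with l(1) that show thesis by blast
qed

text \<open>\<open>asymp_cone\<close> asks for a sequence lying entirely in \<open>A\<close>;
  dropping finitely many terms changes neither limit.\<close>

lemma limitin_eventually_in_asymp_cone:
  assumes "filterlim t at_top sequentially" "\<forall>\<^sub>F k in sequentially. x k \<in> A"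
    and "limitin T (\<lambda>k. x k /\<^sub>R t k) d sequentially"
  shows "d \<in> asymp_cone T A"
proof -
  obtain N where N: "\<And>k. k \<ge> N \<Longrightarrow> x k \<in> A"
    using assms(2) by (auto simp: eventually_sequentially)
  have "strict_mono (\<lambda>k. k + N)" by (simp add: strict_mono_def)
  from limitin_subsequence[OF this assms(3)]
  have "limitin T (\<lambda>k. x (k + N) /\<^sub>R t (k + N)) d sequentially" by (simp add: o_def)
  moreover have "filterlim (\<lambda>k. t (k + N)) at_top sequentially"
    using assms(1) by (rule filterlim_compose[OF _ filterlim_add_const_nat_at_top])
  ultimately show ?thesis
    using N unfolding asymp_cone_def
    by (auto intro!: exI[of _ "\<lambda>k. t (k + N)"] exI[of _ "\<lambda>k. x (k + N)"])
qed

text \<open>Under \<open>assumption_A\<close> this real infimum is a minimum for every point of the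
  domain, so \<open>Inf\<close> takes no default value there.\<close>

definition min_psi :: "'y::real_vector set \<Rightarrow> 'y \<Rightarrow> ('e \<Rightarrow> 'y set) \<Rightarrow> 'e \<Rightarrow> real" where
  "min_psi P q F x = Inf (psi P q ` F x)"

section \<open>Interior points of the cone and the scalarising functional \<open>psi\<close>\<close>

locale tvs_cone =
  fixes P :: "'y::{real_vector,t2_space} set" and q :: 'y
  assumes tvs: "tvs_topology (euclidean :: 'y topology)"
    and closed_P: "closed P" and cone_P: "convex_cone P"
    and P_neq_UNIV: "P \<noteq> UNIV" and q_int: "q \<in> interior P"
begin

text \<open>The sorts of \<open>'y\<close> do not relate topology and algebra; \<open>tvs\<close> is
  the only link. Continuity along lines makes preimages of \<open>P\<close> and
  \<open>interior P\<close> closed and open sets of reals.\<close>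

lemma continuous_affine: "continuous_on UNIV (\<lambda>t::real. t *\<^sub>R a + (b::'y))"
proof -
  have s: "continuous_on UNIV (\<lambda>(c::real, x::'y). c *\<^sub>R x)"
    and p: "continuous_on UNIV (\<lambda>(x::'y, y). x + y)"
    using tvs by (simp_all add: tvs_topology_def)
  have "continuous_on UNIV (\<lambda>t::real. (t, a))" by (intro continuous_intros)
  from continuous_on_compose2[OF s this] have "continuous_on UNIV (\<lambda>t::real. t *\<^sub>R a)" by simp
  then have "continuous_on UNIV (\<lambda>t::real. (t *\<^sub>R a, b))" by (intro continuous_intros)
  from continuous_on_compose2[OF p this] show ?thesis by simp
qed

lemma continuous_affine_space: "continuous_on UNIV (\<lambda>x::'y. (c::real) *\<^sub>R x + b)"
proof -
  have s: "continuous_on UNIV (\<lambda>(c::real, x::'y). c *\<^sub>R x)"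
    and p: "continuous_on UNIV (\<lambda>(x::'y, y). x + y)"
    using tvs by (simp_all add: tvs_topology_def)
  have "continuous_on UNIV (\<lambda>x::'y. (c, x))" by (intro continuous_intros)
  from continuous_on_compose2[OF s this] have "continuous_on UNIV (\<lambda>x::'y. c *\<^sub>R x)" by simp
  then have "continuous_on UNIV (\<lambda>x::'y. (c *\<^sub>R x, b))" by (intro continuous_intros)
  from continuous_on_compose2[OF p this] show ?thesis by simp
qed

lemma cone_add: "x \<in> P \<Longrightarrow> y \<in> P \<Longrightarrow> x + y \<in> P"
  using cone_P by (rule convex_cone_add)

lemma cone_scaleR: "x \<in> P \<Longrightarrow> 0 \<le> c \<Longrightarrow> c *\<^sub>R x \<in> P"
  using cone_P by (simp add: convex_cone_def conic_mul)

lemma cone_scaleR_iff: "0 < c \<Longrightarrow> c *\<^sub>R x \<in> P \<longleftrightarrow> x \<in> P"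
  using cone_scaleR[of x c] cone_scaleR[of "c *\<^sub>R x" "inverse c"] by auto

lemma q_in_P: "q \<in> P"
  using q_int interior_subset by blast

text \<open>An affine map with nonzero factor has a continuous inverse; the preimage of
  \<open>interior P\<close> under that inverse is an open set inside \<open>P\<close> around the
  image point.\<close>

lemma interior_affine_preimage:
  assumes "x \<in> interior P" "c > 0" "\<And>z. z \<in> P \<Longrightarrow> c *\<^sub>R z + b \<in> P"
  shows "c *\<^sub>R x + b \<in> interior P"
proof (rule interiorI)
  let ?f = "\<lambda>z. inverse c *\<^sub>R z + (- inverse c) *\<^sub>R b"
  show "open (?f -` interior P)"
    using open_vimage[OF open_interior continuous_affine_space] .
  show "c *\<^sub>R x + b \<in> ?f -` interior P"
    using assms by (simp add: algebra_simps)
  show "?f -` interior P \<subseteq> P"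
  proof
    fix z assume "z \<in> ?f -` interior P"
    then have "?f z \<in> P" using interior_subset by auto
    from assms(3)[OF this] show "z \<in> P" using assms(2) by (simp add: algebra_simps)
  qed
qed

lemma interior_add: "x \<in> interior P \<Longrightarrow> y \<in> P \<Longrightarrow> x + y \<in> interior P"
  using interior_affine_preimage[of x 1 y] by (simp add: cone_add)

lemma interior_scaleR: "x \<in> interior P \<Longrightarrow> 0 < c \<Longrightarrow> c *\<^sub>R x \<in> interior P"
  using interior_affine_preimage[of x c 0] by (simp add: cone_scaleR)

text \<open>The parameters for which the line through \<open>a\<close> in direction \<open>b\<close>
  meets \<open>interior P\<close> form an open set containing \<open>0\<close>, hence also some
  positive \<open>e\<close>.\<close>

lemma interior_segment:
  assumes "a \<in> interior P"
  obtains e where "e > 0" "e *\<^sub>R b + a \<in> P"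
proof -
  have "open ((\<lambda>t. t *\<^sub>R b + a) -` interior P)"
    using open_vimage[OF open_interior continuous_affine] .
  moreover have "0 \<in> (\<lambda>t. t *\<^sub>R b + a) -` interior P" using assms by simp
  ultimately obtain e where "e > 0" "cball 0 e \<subseteq> (\<lambda>t. t *\<^sub>R b + a) -` interior P"
    unfolding open_contains_cball by blast
  moreover from \<open>e > 0\<close> have "e \<in> cball 0 e" by simp
  ultimately show thesis using that interior_subset by blast
qed

text \<open>Otherwise \<open>e *\<^sub>R z = (e *\<^sub>R z + q) + (- q)\<close> would lie in
  \<open>P\<close> for every \<open>z\<close> and a suitable \<open>e > 0\<close>, making
  \<open>P\<close> the whole space.\<close>

lemma minus_q_notin: "- q \<notin> P"
proof
  assume neg: "- q \<in> P"
  have "z \<in> P" for z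
  proof -
    obtain e where "e > 0" "e *\<^sub>R z + q \<in> P" using interior_segment[OF q_int] .
    with cone_add[OF _ neg] have "e *\<^sub>R z \<in> P" by fastforce
    with \<open>e > 0\<close> show ?thesis by (simp add: cone_scaleR_iff)
  qed
  with P_neq_UNIV show False by blast
qed

lemma mem_ray_down:
  assumes "y - t *\<^sub>R q \<in> P" "s \<le> t"
  shows "y - s *\<^sub>R q \<in> P"
  using cone_add[OF assms(1) cone_scaleR[OF q_in_P, of "t - s"]] assms(2)
  by (simp add: algebra_simps)

lemma mem_translate_iff: "y \<in> {a} + A \<longleftrightarrow> y - a \<in> A" for a y :: 'y
  by (auto simp: set_plus_def algebra_simps intro: bexI[of _ "y - a"])

text \<open>The admissible \<open>t\<close> form a closed half-line that is unbounded below: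
  nonempty because \<open>q\<close> is interior, bounded above because \<open>- q\<close> is not in
  \<open>P\<close>, closed because \<open>P\<close> is. The supremum is thus attained.\<close>

lemma le_psi_iff: "y \<in> {t *\<^sub>R q} + P \<longleftrightarrow> t \<le> psi P q y"
proof -
  define S where "S = {t. y - t *\<^sub>R q \<in> P}"
  have psi: "psi P q y = Sup S"
    by (simp add: psi_def S_def mem_translate_iff)
  have "S = (\<lambda>t. t *\<^sub>R (- q) + y) -` P"
    by (auto simp: S_def)
  also have "closed \<dots>"
    using closed_vimage[OF closed_P continuous_affine] .
  finally have closed_S: "closed S" .
  obtain e where e: "e > 0" "e *\<^sub>R y + q \<in> P" using interior_segment[OF q_int] .
  then have "inverse e *\<^sub>R (e *\<^sub>R y + q) \<in> P" by (simp add: cone_scaleR)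
  then have "- inverse e \<in> S" using e by (simp add: S_def algebra_simps)
  then have ne: "S \<noteq> {}" by blast
  have bdd: "bdd_above S"
  proof (rule ccontr)
    assume unbdd: "\<not> bdd_above S"
    \<comment> \<open>Arbitrarily large \<open>t\<close> put
      \<open>y - inverse s *\<^sub>R q\<close> in \<open>P\<close>; multiply by \<open>s\<close>.
      Letting \<open>s\<close> tend to \<open>0\<close> then gives \<open>- q\<close> in the closed
      set \<open>P\<close>.\<close>
    have "s *\<^sub>R y + (- q) \<in> P" if "s > 0" for s
    proof -
      obtain t where "t \<in> S" "t > inverse s"
        using unbdd unfolding bdd_above_def by (meson not_le)
      then have "y - inverse s *\<^sub>R q \<in> P"
        unfolding S_def by (auto intro: mem_ray_down)
      from cone_scaleR[OF this, of s] that show ?thesis by (simp add: algebra_simps)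
    qed
    then have "{0<..} \<subseteq> (\<lambda>s. s *\<^sub>R y + (- q)) -` P" by auto
    from closure_minimal[OF this closed_vimage[OF closed_P continuous_affine]]
    have "- q \<in> P" by (auto simp: subset_iff)
    with minus_q_notin show False ..
  qed
  have "Sup S \<in> S" using closed_contains_Sup[OF ne bdd closed_S] .
  then have "t \<in> S \<longleftrightarrow> t \<le> Sup S"
    using cSup_upper[OF _ bdd] mem_ray_down unfolding S_def by blast
  then show ?thesis by (simp add: psi S_def mem_translate_iff)
qed

text \<open>An interior point leaves room for a further step \<open>e\<close> along
  \<open>- q\<close>, which raises the level. Conversely, \<open>y - t *\<^sub>R q\<close> is the
  sum of the interior point \<open>(psi P q y - t) *\<^sub>R q\<close> and a point of
  \<open>P\<close>.\<close>

lemma less_psi_iff: "y \<in> {t *\<^sub>R q} + interior P \<longleftrightarrow> t < psi P q y"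
proof
  assume "y \<in> {t *\<^sub>R q} + interior P"
  then obtain e where "e > 0" "e *\<^sub>R (- q) + (y - t *\<^sub>R q) \<in> P"
    unfolding mem_translate_iff by (rule interior_segment)
  then have "y \<in> {(t + e) *\<^sub>R q} + P" unfolding mem_translate_iff by (simp add: algebra_simps)
  then show "t < psi P q y" using \<open>e > 0\<close> by (simp add: le_psi_iff)
next
  assume less: "t < psi P q y"
  have "y - psi P q y *\<^sub>R q \<in> P" using le_psi_iff[of y "psi P q y"] by (simp add: mem_translate_iff)
  from interior_add[OF interior_scaleR[OF q_int, of "psi P q y - t"] this] less
  show "y \<in> {t *\<^sub>R q} + interior P" unfolding mem_translate_iff by (simp add: algebra_simps)
qed

section \<open>Colevel sets, infimal level and order relations expressed through
  \<open>min_psi\<close>\<close>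

context
  fixes F :: "'e \<Rightarrow> 'y set" and K :: "'e set"
  assumes A: "assumption_A P q F K"
begin

lemma min_psi_attained:
  assumes "x \<in> K"
  obtains y where "y \<in> F x" "psi P q y = min_psi P q F x" "\<And>z. z \<in> F x \<Longrightarrow> psi P q y \<le> psi P q z"
proof -
  obtain y where "y \<in> F x" "\<forall>z\<in>F x. psi P q y \<le> psi P q z"
    using A assms unfolding assumption_A_def by blast
  moreover from this have "min_psi P q F x = psi P q y"
    unfolding min_psi_def by (intro cInf_eq_minimum) auto
  ultimately show thesis using that by auto
qed

lemma le_min_psi_iff: "x \<in> K \<Longrightarrow> F x \<subseteq> {t *\<^sub>R q} + P \<longleftrightarrow> t \<le> min_psi P q F x"
  by (rule min_psi_attained, assumption) (force simp: subset_iff le_psi_iff)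

text \<open>Attainment makes the strict case exact: if all values of \<open>psi\<close> on
  \<open>F x\<close> exceed \<open>t\<close>, so does their minimum.\<close>

lemma less_min_psi_iff: "x \<in> K \<Longrightarrow> lless P {t *\<^sub>R q} (F x) \<longleftrightarrow> t < min_psi P q F x"
  by (rule min_psi_attained, assumption) (force simp: lless_def subset_iff less_psi_iff)

lemma Colev_eq: "D \<subseteq> K \<Longrightarrow> Colev P q F D t = {x \<in> D. min_psi P q F x \<le> t}"
  unfolding Colev_def using less_min_psi_iff by (force simp: not_less)

text \<open>A supremum of real lower bounds is the infimum, also when it is infinite: by density,
  any \<open>y\<close> below the infimum has a real lower bound above it.\<close>

lemma inf_level_eq:
  assumes "D \<subseteq> K"
  shows "inf_level P q F D = (INF x\<in>D. ereal (min_psi P q F x))"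
proof -
  have "(\<Union>x\<in>D. F x) \<subseteq> {t *\<^sub>R q} + P \<longleftrightarrow> (\<forall>x\<in>D. t \<le> min_psi P q F x)" for t
    using le_min_psi_iff assms by (simp add: UN_subset_iff subset_iff[of D K])
  then have "inf_level P q F D = Sup (ereal ` {t. \<forall>x\<in>D. t \<le> min_psi P q F x})"
    by (simp add: inf_level_def)
  also have "\<dots> = (INF x\<in>D. ereal (min_psi P q F x))"
  proof (rule antisym)
    show "Sup (ereal ` {t. \<forall>x\<in>D. t \<le> min_psi P q F x}) \<le> (INF x\<in>D. ereal (min_psi P q F x))"
      by (auto intro!: Sup_least INF_greatest)
    show "(INF x\<in>D. ereal (min_psi P q F x)) \<le> Sup (ereal ` {t. \<forall>x\<in>D. t \<le> min_psi P q F x})"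
    proof (rule dense_le)
      fix y assume "y < (INF x\<in>D. ereal (min_psi P q F x))"
      then obtain z where z: "y < ereal z" "ereal z < (INF x\<in>D. ereal (min_psi P q F x))"
        using ereal_dense2 by blast
      then have "\<forall>x\<in>D. z \<le> min_psi P q F x"
        by (metis INF_lower ereal_less_eq(3) less_imp_le order_trans)
      then have "ereal z \<le> Sup (ereal ` {t. \<forall>x\<in>D. t \<le> min_psi P q F x})"
        by (auto intro: Sup_upper)
      with z(1) show "y \<le> Sup (ereal ` {t. \<forall>x\<in>D. t \<le> min_psi P q F x})" by simp
    qed
  qed
  finally show ?thesis .
qed

text \<open>Any translate of \<open>P\<close> containing \<open>F y\<close> contains
  \<open>F y + P\<close>, hence \<open>F x\<close>; apply this at the level
  \<open>min_psi P q F y\<close>.\<close>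

lemma min_psi_mono:
  assumes "x \<in> K" "y \<in> K" "lleq P (F y) (F x)"
  shows "min_psi P q F y \<le> min_psi P q F x"
proof -
  let ?t = "min_psi P q F y"
  have y: "F y \<subseteq> {?t *\<^sub>R q} + P" using le_min_psi_iff[OF assms(2)] by blast
  have "F x \<subseteq> {?t *\<^sub>R q} + P"
  proof
    fix z assume "z \<in> F x"
    then obtain v p where v: "v \<in> F y" "p \<in> P" "z = v + p"
      using assms(3) by (auto simp: lleq_def elim!: set_plus_elim)
    with y have "v - ?t *\<^sub>R q \<in> P" by (auto simp: mem_translate_iff[symmetric])
    from cone_add[OF this v(2)] v(3) show "z \<in> {?t *\<^sub>R q} + P"
      unfolding mem_translate_iff by (simp add: algebra_simps)
  qed
  then show ?thesis by (simp add: le_min_psi_iff assms(1))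
qed

text \<open>As in the weak case, with \<open>P + interior P\<close> contained in
  \<open>interior P\<close>; \<open>less_min_psi_iff\<close> then yields strictness.\<close>

lemma min_psi_strict_mono:
  assumes "x \<in> K" "y \<in> K" "lless P (F y) (F x)"
  shows "min_psi P q F y < min_psi P q F x"
proof -
  let ?t = "min_psi P q F y"
  have y: "F y \<subseteq> {?t *\<^sub>R q} + P" using le_min_psi_iff[OF assms(2)] by blast
  have "F x \<subseteq> {?t *\<^sub>R q} + interior P"
  proof
    fix z assume "z \<in> F x"
    then obtain v p where v: "v \<in> F y" "p \<in> interior P" "z = v + p"
      using assms(3) by (auto simp: lless_def elim!: set_plus_elim)
    with y have "v - ?t *\<^sub>R q \<in> P" by (auto simp: mem_translate_iff[symmetric])
    from interior_add[OF v(2) this] v(3) show "z \<in> {?t *\<^sub>R q} + interior P"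
      unfolding mem_translate_iff by (simp add: algebra_simps)
  qed
  then show ?thesis using less_min_psi_iff[OF assms(1)] by (simp add: lless_def)
qed

lemma minimiser_in_SWEff:
  assumes "x \<in> K" "\<And>z. z \<in> K \<Longrightarrow> min_psi P q F x \<le> min_psi P q F z"
  shows "x \<in> SWEff P F K"
  using assms min_psi_strict_mono by (force simp: SWEff_def)

lemma srgi_attains_min:
  assumes "srgi (subtopology T S) P q F" "seq_compactin T S" "S \<noteq> {}" "S \<subseteq> K" "topspace T = UNIV"
  obtains x where "x \<in> S" "\<And>z. z \<in> S \<Longrightarrow> min_psi P q F x \<le> min_psi P q F z"
proof (rule seq_compactin_attains_min[OF assms(2,3), of "min_psi P q F"])
  let ?M = "INF z\<in>S. ereal (min_psi P q F z)"
  fix x assume x: "x \<in> S" "?M < ereal (min_psi P q F x)"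
  \<comment> \<open>A level strictly between the infimum and the value at \<open>x\<close> places
    \<open>x\<close> outside the colevel set, as \<open>srgi\<close> requires; the \<open>r\<close>
    it returns is the local bound.\<close>
  obtain lam where lam: "?M < ereal lam" "lam < min_psi P q F x"
    using ereal_dense2[OF x(2)] by auto
  have top: "topspace (subtopology T S) = S" using assms(5) by simp
  have reg: "\<exists>U r. openin (subtopology T S) U \<and> x0 \<in> U \<and> inf_level P q F S < ereal r \<and>
      U \<subseteq> S - Colev P q F S r"
    if "inf_level P q F S < ereal lam" "x0 \<in> S - Colev P q F S lam" for x0 lam
    using assms(1)[unfolded srgi_def Let_def top, rule_format, OF conjI[OF that]] .
  have M: "?M = inf_level P q F S" using inf_level_eq[OF assms(4)] by simp
  have "x \<in> S - Colev P q F S lam" using x lam by (simp add: Colev_eq[OF assms(4)])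
  from reg[OF _ this] lam(1) obtain U r where "openin (subtopology T S) U" "x \<in> U" "?M < ereal r"
      "U \<subseteq> S - Colev P q F S r"
    unfolding M by blast
  then show "\<exists>U r. openin (subtopology T S) U \<and> x \<in> U \<and> ?M < ereal r \<and> (\<forall>u\<in>U. r < min_psi P q F u)"
    by (intro exI[of _ U] exI[of _ r]) (auto simp: Colev_eq[OF assms(4)] subset_iff not_le)
qed (use that in blast)

end

text \<open>A colevel set whose asymptotic cone is inhabited contains a point, so its level is at
  least the infimal level.\<close>

lemma qx_asymp_zero_ge:
  fixes F :: "'e::real_vector \<Rightarrow> 'y set"
  assumes A: "assumption_A P q F K"
  shows "inf_level P q F K \<le> qx_asymp T P q F K 0"
proof -
  have "inf_level P q F K \<le> ereal lam" if zero: "0 \<in> asymp_cone T (Colev P q F K lam)" for lam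
  proof -
    obtain x :: "nat \<Rightarrow> 'e" where "range x \<subseteq> Colev P q F K lam"
      using zero unfolding asymp_cone_def mem_Collect_eq by blast
    then have "x 0 \<in> Colev P q F K lam" by (simp add: image_subset_iff)
    then have "x 0 \<in> K" "min_psi P q F (x 0) \<le> lam"
      by (simp_all add: Colev_eq[OF A])
    then show ?thesis
      unfolding inf_level_eq[OF A order_refl] by (intro INF_lower2[of "x 0"]) auto
  qed
  then show ?thesis unfolding qx_asymp_def by (auto intro!: Inf_greatest)
qed

end

section \<open>Existence of strict weakly l-efficient solutions\<close>

theorem theorem5p2:
  fixes \<sigma> :: "'e::banach topology"
    and K :: "'e set"
    and P :: "'y::{real_vector,t2_space} set"
    and q :: 'y
    and F :: "'e \<Rightarrow> 'y set"
  assumes sigma_tvs: "tvs_topology \<sigma>" "Hausdorff_space \<sigma>"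
    and sigma_coarser: "\<And>U. openin \<sigma> U \<Longrightarrow> open U"
    and Y_tvs: "tvs_topology (euclidean :: 'y topology)"
    and P_cone: "closed P" "convex_cone P"
    and P_solid: "interior P \<noteq> {}"
    and P_proper: "P \<noteq> {0}" "P \<noteq> UNIV"
    and q: "q \<in> interior P"
    and K: "K \<noteq> {}" "closedin \<sigma> K" "convex K"
    and F_nonempty: "\<And>x. x \<in> K \<Longrightarrow> F x \<noteq> {}"
    and F_A: "assumption_A P q F K"
    and B_E: "closedin \<sigma> (cball 0 1)" "seq_compactin \<sigma> (cball 0 1)"
    and F_bounded: "P_bounded P (\<Union>x\<in>K. F x)"
    and F_srgi: "\<And>n. srgi (subtopology \<sigma> (ball_part K n)) P q F"
    and F_asymp: "\<And>u. u \<in> asymp_cone \<sigma> K - {0} \<Longrightarrow> qx_asymp \<sigma> P q F K u > qx_asymp \<sigma> P q F K 0"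
    and cond: "unbounded_seq_condition \<sigma> P q F K"
  shows "SWEff P F K \<noteq> {} \<and> SWEff P F K \<subseteq> K"
proof -
  interpret tvs_cone P q
    using Y_tvs P_cone P_proper q by unfold_locales
  define g where "g = min_psi P q F"
  define M where "M = inf_level P q F K"
  have M: "M = (INF x\<in>K. ereal (g x))"
    unfolding M_def g_def using inf_level_eq[OF F_A order_refl] .
  have M_le: "M \<le> ereal (g x)" if "x \<in> K" for x
    unfolding M using that by (rule INF_lower)
  have Colev: "Colev P q F K lam = {x \<in> K. g x \<le> lam}" for lam
    unfolding g_def using Colev_eq[OF F_A order_refl] .
  have "\<exists>x\<in>K. \<forall>z\<in>K. g x \<le> g z"
  proof (rule ccontr)
    assume no_min: "\<not> (\<exists>x\<in>K. \<forall>z\<in>K. g x \<le> g z)"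
    \<comment> \<open>Without a minimiser every value has a smaller one, so \<open>M\<close> is
      never attained; this covers \<open>M\<close> being minus infinity.\<close>
    have M_less: "M < ereal (g x)" if x: "x \<in> K" for x
    proof -
      obtain z where "z \<in> K" "g z < g x" using no_min x by (meson not_le)
      then show ?thesis using M_le[of z] by (meson le_less_trans ereal_less(2) less_ereal.simps(1))
    qed
    have ball_mono: "ball_part K m \<subseteq> ball_part K n" if "m \<le> n" for m n
      using that by (auto simp: ball_part_def)
    have ball_cover: "z \<in> ball_part K n" if "z \<in> K" "norm z \<le> real n" for z n
      using that by (simp add: ball_part_def)
    obtain z0 where "z0 \<in> K" using K by blast
    then have ex: "\<exists>n. ball_part K n \<noteq> {}"
      using ball_cover real_arch_simple by blast
    \<comment> \<open>The first balls may miss \<open>K\<close>. Minimising over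
      \<open>ball_part K (max n n0)\<close> defines \<open>x n\<close> for every \<open>n\<close>
      and agrees with \<open>ball_part K n\<close> whenever that set is nonempty.\<close>
    define n0 where "n0 = (LEAST n. ball_part K n \<noteq> {})"
    have n0: "ball_part K n0 \<noteq> {}" unfolding n0_def using ex by (rule LeastI_ex)
    have n0_le: "n0 \<le> n" if "ball_part K n \<noteq> {}" for n
      unfolding n0_def using that by (rule Least_le)
    have "\<exists>x. x \<in> ball_part K (max n n0) \<and> (\<forall>z\<in>ball_part K (max n n0). g x \<le> g z)" for n
    proof -
      have "ball_part K (max n n0) \<noteq> {}" using n0 ball_mono[of n0 "max n n0"] by auto
      moreover have "ball_part K (max n n0) \<subseteq> K" by (auto simp: ball_part_def)
      ultimately show ?thesis
        using srgi_attains_min[OF F_A F_srgi seq_compactin_ball_part[OF sigma_tvs(1) K(2) B_E(2)]]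
          sigma_tvs(1) unfolding tvs_topology_def g_def by metis
    qed
    then obtain x where x: "\<And>n. x n \<in> ball_part K (max n n0)"
        "\<And>n z. z \<in> ball_part K (max n n0) \<Longrightarrow> g (x n) \<le> g z"
      by metis
    have xK: "x n \<in> K" for n using x(1)[of n] by (simp add: ball_part_def)
    \<comment> \<open>On a fixed ball \<open>g\<close> is at least its minimum
      \<open>g (x m)\<close>, which exceeds \<open>M\<close>, so a minimising sequence eventually
      leaves the ball. This serves both \<open>x\<close> and \<open>w\<close>.\<close>
    have escape: "filterlim (\<lambda>n. norm (v n)) at_top sequentially"
      if v: "\<And>n. v n \<in> K" "(\<lambda>n. ereal (g (v n))) \<longlonglongrightarrow> M" for v
      unfolding filterlim_at_top
    proof
      fix Z :: real
      obtain m where m: "Z \<le> real m" using real_arch_simple by blast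
      have "\<forall>\<^sub>F n in sequentially. ereal (g (v n)) < ereal (g (x m))"
        using order_tendstoD(2)[OF v(2) M_less[OF xK]] .
      then show "\<forall>\<^sub>F n in sequentially. Z \<le> norm (v n)"
      proof eventually_elim
        case (elim n)
        then have "v n \<notin> ball_part K (max m n0)" using x(2)[of "v n" m] by auto
        then have "\<not> norm (v n) \<le> real (max m n0)" using ball_cover[OF v(1)] by blast
        then show ?case using m by simp
      qed
    qed
    \<comment> \<open>Taking the minimal values themselves as levels puts \<open>x n\<close> in its
      colevel set with equality.\<close>
    define lam where "lam = (\<lambda>n. g (x n))"
    have lam_tendsto: "(\<lambda>n. ereal (lam n)) \<longlonglongrightarrow> M"
    proof (rule order_tendstoI)
      fix a assume "a < M"
      then show "\<forall>\<^sub>F n in sequentially. a < ereal (lam n)"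
        using M_le[OF xK] unfolding lam_def by (intro always_eventually allI) (rule less_le_trans)
    next
      \<comment> \<open>Some \<open>z\<close> has value below \<open>a\<close>; once the ball
        contains \<open>z\<close>, its minimum is below \<open>a\<close> too.\<close>
      fix a assume "M < a"
      then obtain z where z: "z \<in> K" "ereal (g z) < a" unfolding M INF_less_iff by blast
      obtain m where m: "norm z \<le> real m" using real_arch_simple by blast
      have "ereal (lam n) < a" if "n \<ge> m" for n
      proof -
        have "z \<in> ball_part K (max n n0)" using z(1) m that by (intro ball_cover) auto
        from x(2)[OF this] have "ereal (lam n) \<le> ereal (g z)" by (simp add: lam_def)
        with z(2) show ?thesis by (rule le_less_trans[rotated])
      qed
      then show "\<forall>\<^sub>F n in sequentially. ereal (lam n) < a"
        unfolding eventually_sequentially by blast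
    qed
    have "lam n \<le> lam m" if "m \<le> n" for m n
    proof -
      have "max m n0 \<le> max n n0" using that by auto
      from ball_mono[OF this] show ?thesis
        unfolding lam_def using x(1)[of m] by (rule x(2)[OF subsetD])
    qed
    then have lam_dec: "decreases_to lam (inf_level P q F K)"
      unfolding decreases_to_def M_def[symmetric]
      using lam_tendsto M_less[OF xK] by (auto simp: lam_def decseq_def)
    have x_inf: "filterlim (\<lambda>n. norm (x n)) at_top sequentially"
      using escape[OF xK] lam_tendsto by (simp add: lam_def)
    have x_unbdd: "\<not> bounded (range x)"
    proof
      assume "bounded (range x)"
      then obtain B where B: "\<And>n. norm (x n) \<le> B" unfolding bounded_iff by auto
      have "\<forall>\<^sub>F n in sequentially. B < norm (x n)"
        using x_inf by (simp add: filterlim_at_top_dense)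
      then have "\<forall>\<^sub>F n in sequentially. False"
        by eventually_elim (use B in \<open>simp add: not_less[symmetric]\<close>)
      then show False by simp
    qed
    have x_Colev: "x n \<in> Colev P q F K (lam n) \<inter> ball_part K n" if "ball_part K n \<noteq> {}" for n
      using x(1)[of n] n0_le[OF that] xK[of n] by (simp add: Colev lam_def max_absorb1)
    have "range x \<subseteq> K \<and> \<not> bounded (range x) \<and> decreases_to lam (inf_level P q F K) \<and>
        (\<forall>n. ball_part K n \<noteq> {} \<longrightarrow> x n \<in> Colev P q F K (lam n) \<inter> ball_part K n) \<and>
        filterlim (\<lambda>n. norm (x n)) at_top sequentially"
      using xK x_unbdd lam_dec x_Colev x_inf by blast
    from cond[unfolded unbounded_seq_condition_def, rule_format, OF this]
    obtain s w d where s: "strict_mono s" and w: "range w \<subseteq> K"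
      and d: "d \<in> asymp_cone \<sigma> K - {0}"
      and ev: "\<forall>\<^sub>F k in sequentially. lleq P (F (w k)) (F (x (s k))) \<and> norm (w k) \<le> norm (x (s k))"
      and lim: "limitin \<sigma> (\<lambda>k. w k /\<^sub>R norm (w k)) d sequentially"
      by (elim exE conjE) (rule that)
    have wK: "w k \<in> K" for k using w by blast
    \<comment> \<open>Passing to smaller values in the order does not increase \<open>g\<close>, so
      \<open>w\<close> is squeezed between \<open>M\<close> and a subsequence of
      \<open>lam\<close>.\<close>
    have w_min: "(\<lambda>k. ereal (g (w k))) \<longlonglongrightarrow> M"
    proof (rule tendsto_sandwich[where f = "\<lambda>_. M"])
      show "(\<lambda>k. ereal (lam (s k))) \<longlonglongrightarrow> M"
        using LIMSEQ_subseq_LIMSEQ[OF lam_tendsto s] by (simp add: o_def)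
      show "\<forall>\<^sub>F k in sequentially. ereal (g (w k)) \<le> ereal (lam (s k))"
        using ev by eventually_elim (simp add: lam_def g_def min_psi_mono[OF F_A xK wK])
    qed (use M_le[OF wK] in auto)
    \<comment> \<open>For each real \<open>c\<close> above \<open>M\<close>, \<open>w\<close>
      eventually stays in the colevel set of level \<open>c\<close>. Its norms tend to infinity by
      \<open>escape\<close>, so they serve as the scaling factors that exhibit \<open>d\<close> in
      the asymptotic cone.\<close>
    have "qx_asymp \<sigma> P q F K d \<le> M"
    proof (rule dense_ge)
      fix y assume "M < y"
      then obtain c where c: "M < ereal c" "ereal c < y" using ereal_dense2 by blast
      have "\<forall>\<^sub>F k in sequentially. ereal (g (w k)) < ereal c"
        using order_tendstoD(2)[OF w_min c(1)] .
      then have "\<forall>\<^sub>F k in sequentially. w k \<in> Colev P q F K c"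
        by eventually_elim (simp add: Colev wK)
      then have "d \<in> asymp_cone \<sigma> (Colev P q F K c)"
        using escape[OF wK w_min] lim by (intro limitin_eventually_in_asymp_cone)
      then have "qx_asymp \<sigma> P q F K d \<le> ereal c"
        unfolding qx_asymp_def by (auto intro: Inf_lower)
      with c(2) show "qx_asymp \<sigma> P q F K d \<le> y" by simp
    qed
    also have "M \<le> qx_asymp \<sigma> P q F K 0"
      unfolding M_def using qx_asymp_zero_ge[OF F_A] .
    finally show False using F_asymp[OF d] by simp
  qed
  then obtain x where "x \<in> K" "\<And>z. z \<in> K \<Longrightarrow> g x \<le> g z" by blast
  then have "x \<in> SWEff P F K" unfolding g_def using minimiser_in_SWEff[OF F_A] by blast
  then show ?thesis by (auto simp: SWEff_def)
qed

end
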